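(* Let $G$ be a finite group of order $n$ with identity $e$, and let $S\subseteq G\setminus\{e\}$ satisfy $S=S^{-1}$ and $G=\langle S\rangle$. Then $\gamma_{S}(\mathrm{Cay}(S:G))=1$ if and only if $S=G\setminus\{e\}$ and $n$ is odd.
   Context: $\mathrm{Cay}(S:G)$ is the simple graph with vertex set $G$ in which $a$ and $b$ are adjacent if and only if $ab^{-1}\in S$. For a graph $\Gamma$, $N[v]$ denotes the closed neighborhood of $v$ (the vertex $v$ together with all its neighbors). A signed dominating function of $\Gamma$ is a function $g:V(\Gamma)\to\{-1,1\}$ with $\sum_{u\in N[v]}g(u)>0$ for every $v\in V(\Gamma)$; its weight is $\sum_{v\in V(\Gamma)}g(v)$. The signed domination number $\gamma_{S}(\Gamma)$ is the minimum weight of a signed dominating function of $\Gamma$ (the subscript $S$ in $\gamma_S$ is part of the notation and unrelated to the set $S$). *)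

theory Defs
  imports "HOL-Algebra.Generated_Groups" "Graph_Theory.Pair_Digraph"
begin

text \<open>
  A finite simple graph is a \<^locale>\<open>pair_graph\<close>: a finite, symmetric, loop-free arc relation
  \<^const>\<open>parcs\<close> on the vertex set \<^const>\<open>pverts\<close>, with each edge represented by its two arcs.
\<close>

definition closed_neighborhood :: "'a pair_pre_digraph \<Rightarrow> 'a \<Rightarrow> 'a set" where
  "closed_neighborhood \<Gamma> v = insert v {u \<in> pverts \<Gamma>. (v, u) \<in> parcs \<Gamma>}"

text \<open>
  The values of \<open>g\<close> outside the vertex set are unconstrained and irrelevant.
\<close>

definition signed_dominating :: "'a pair_pre_digraph \<Rightarrow> ('a \<Rightarrow> int) \<Rightarrow> bool" where
  "signed_dominating \<Gamma> g \<longleftrightarrow>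
     g ` pverts \<Gamma> \<subseteq> {-1, 1} \<and> (\<forall>v \<in> pverts \<Gamma>. (\<Sum>u \<in> closed_neighborhood \<Gamma> v. g u) > 0)"

definition signed_weight :: "'a pair_pre_digraph \<Rightarrow> ('a \<Rightarrow> int) \<Rightarrow> int" where
  "signed_weight \<Gamma> g = (\<Sum>v \<in> pverts \<Gamma>. g v)"

definition signed_domination_number :: "'a pair_pre_digraph \<Rightarrow> int" where
  "signed_domination_number \<Gamma> = Min {signed_weight \<Gamma> g | g. signed_dominating \<Gamma> g}"

text \<open>The minimum is taken over a finite nonempty set, so it is attained.\<close>

lemma (in pair_graph) finite_signed_weights:
  "finite {signed_weight G g | g. signed_dominating G g}"
proof (rule finite_subset)
  let ?n = "int (card (pverts G))"
  show "{signed_weight G g | g. signed_dominating G g} \<subseteq> {- ?n .. ?n}"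
  proof clarify
    fix g assume "signed_dominating G g"
    then have b: "\<bar>g v\<bar> \<le> 1" if "v \<in> pverts G" for v
      using that unfolding signed_dominating_def by fastforce
    have "\<bar>signed_weight G g\<bar> \<le> (\<Sum>v \<in> pverts G. \<bar>g v\<bar>)"
      unfolding signed_weight_def by (rule sum_abs)
    also have "\<dots> \<le> (\<Sum>v \<in> pverts G. 1)" by (rule sum_mono) (rule b)
    finally show "signed_weight G g \<in> {- ?n .. ?n}" by auto
  qed
qed simp

lemma (in pair_graph) signed_dominating_const_1: "signed_dominating G (\<lambda>_. 1)"
proof -
  have "finite (closed_neighborhood G v)" for v
    unfolding closed_neighborhood_def using pair_finite_verts by simp
  moreover have "closed_neighborhood G v \<noteq> {}" for v
    unfolding closed_neighborhood_def by simp
  ultimately show ?thesis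
    unfolding signed_dominating_def by (auto simp: card_gt_0_iff)
qed

lemma (in pair_graph) signed_domination_number_attained:
  "\<exists>g. signed_dominating G g \<and> signed_weight G g = signed_domination_number G"
proof -
  have "signed_domination_number G \<in> {signed_weight G g | g. signed_dominating G g}"
    unfolding signed_domination_number_def
    using finite_signed_weights signed_dominating_const_1 by (intro Min_in) auto
  then show ?thesis by auto
qed

definition cayley_graph :: "'a set \<Rightarrow> ('a, 'b) monoid_scheme \<Rightarrow> 'a pair_pre_digraph" where
  "cayley_graph S G =
     \<lparr> pverts = carrier G,
       parcs = {(a, b) \<in> carrier G \<times> carrier G. a \<otimes>\<^bsub>G\<^esub> inv\<^bsub>G\<^esub> b \<in> S} \<rparr>"

text \<open>
  The arc relation is symmetric because \<open>S\<close> is closed under inverses, and loop-free because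
  \<open>S\<close> does not contain the identity.
\<close>

lemma (in group) cayley_graph_is_pair_graph:
  assumes fin: "finite (carrier G)" and S: "S \<subseteq> carrier G - {\<one>}" and inv: "set_inv S = S"
  shows "pair_graph (cayley_graph S G)"
proof
  show "finite (pverts (cayley_graph S G))"
    using fin by (simp add: cayley_graph_def)
  have "parcs (cayley_graph S G) \<subseteq> carrier G \<times> carrier G"
    by (auto simp: cayley_graph_def)
  then show "finite (parcs (cayley_graph S G))"
    using fin by (meson finite_SigmaI finite_subset)
  show "fst e \<in> pverts (cayley_graph S G)" "snd e \<in> pverts (cayley_graph S G)"
    "fst e \<noteq> snd e" if "e \<in> parcs (cayley_graph S G)" for e
    using that S by (auto simp: cayley_graph_def)
  show "symmetric (with_proj (cayley_graph S G))"
    unfolding symmetric_def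
  proof (rule symI)
    fix a b assume "(a, b) \<in> arcs_ends (with_proj (cayley_graph S G))"
    then have ab: "a \<in> carrier G" "b \<in> carrier G" "a \<otimes> inv b \<in> S"
      by (auto simp: cayley_graph_def)
    have "inv (a \<otimes> inv b) \<in> S"
      using ab(3) inv unfolding SET_INV_def by blast
    then show "(b, a) \<in> arcs_ends (with_proj (cayley_graph S G))"
      using ab by (simp add: cayley_graph_def inv_mult_group)
  qed
qed

end

theory Submission
  imports Defs
begin

text \<open>
  In a graph all of whose closed neighborhoods have \<open>k\<close> elements, summing \<open>g(N[v]) \<ge> 1\<close> over
  all \<open>n\<close> vertices counts every value of \<open>g\<close> exactly \<open>k\<close> times, so \<open>n \<le> k \<gamma>\<^sub>S\<close>. For the Cayley graph
  \<open>k = |S| + 1 \<le> n\<close>, so \<open>\<gamma>\<^sub>S = 1\<close> forces \<open>k = n\<close>; and every weight has the parity of \<open>n\<close>.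
\<close>

text \<open>Each value is \<open>1\<close> or \<open>-1\<close>, hence odd, and a sum of odd
  integers has the parity of the number of its terms.\<close>

lemma even_signed_weight_iff:
  assumes "finite (pverts \<Gamma>)" and "signed_dominating \<Gamma> g"
  shows "even (signed_weight \<Gamma> g) \<longleftrightarrow> even (card (pverts \<Gamma>))"
proof -
  have "odd (g v)" if "v \<in> pverts \<Gamma>" for v
    using assms(2) that unfolding signed_dominating_def by fastforce
  then have "{v \<in> pverts \<Gamma>. odd (g v)} = pverts \<Gamma>"
    by blast
  then show ?thesis
    using assms(1) by (simp add: signed_weight_def even_sum_iff)
qed

context pair_graph
begin

lemma signed_domination_number_le:
  assumes "signed_dominating G g"
  shows "signed_domination_number G \<le> signed_weight G g"
  unfolding signed_domination_number_def
  using assms by (intro Min_le finite_signed_weights) blast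

lemma closed_neighborhood_subset:
  assumes "v \<in> pverts G"
  shows "closed_neighborhood G v \<subseteq> pverts G"
  using assms by (auto simp: closed_neighborhood_def)

lemma closed_neighborhood_sym:
  assumes "u \<in> pverts G" and "v \<in> closed_neighborhood G u"
  shows "u \<in> closed_neighborhood G v"
  using assms arcs_symmetric by (auto simp: closed_neighborhood_def)

text \<open>Double counting: a vertex \<open>u\<close> contributes \<open>g u\<close> once for each
  \<open>v\<close> whose closed neighborhood contains it. By symmetry these \<open>v\<close> form
  the closed neighborhood of \<open>u\<close>, so there are \<open>k\<close> of them.\<close>

lemma sum_closed_neighborhoods:
  fixes g :: "'a \<Rightarrow> int"
  assumes "\<And>v. v \<in> pverts G \<Longrightarrow> card (closed_neighborhood G v) = k"
  shows "(\<Sum>v \<in> pverts G. \<Sum>u \<in> closed_neighborhood G v. g u) = int k * signed_weight G g"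
proof -
  let ?N = "closed_neighborhood G"
  \<comment> \<open>The first form exposes the membership condition needed to exchange the sums; the
    second identifies the inner index set after the exchange as a closed neighborhood, whose
    cardinality is \<open>k\<close>.\<close>
  have N: "?N v = {u \<in> pverts G. u \<in> ?N v}" "?N v = {u \<in> pverts G. v \<in> ?N u}"
    if "v \<in> pverts G" for v
    using that closed_neighborhood_subset closed_neighborhood_sym by blast+
  have "(\<Sum>v \<in> pverts G. \<Sum>u \<in> ?N v. g u) = (\<Sum>v \<in> pverts G. \<Sum>u \<in> {u \<in> pverts G. u \<in> ?N v}. g u)"
    using N(1) by (intro sum.cong) auto
  also have "\<dots> = (\<Sum>u \<in> pverts G. \<Sum>v \<in> {v \<in> pverts G. u \<in> ?N v}. g u)"
    by (rule sum.swap_restrict) simp_all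
  also have "\<dots> = (\<Sum>u \<in> pverts G. int k * g u)"
  proof (rule sum.cong)
    fix u assume u: "u \<in> pverts G"
    then show "(\<Sum>v \<in> {v \<in> pverts G. u \<in> ?N v}. g u) = int k * g u"
      by (simp flip: N(2) add: assms)
  qed simp
  finally show ?thesis
    by (simp add: signed_weight_def sum_distrib_left)
qed

text \<open>Apply the double count to a function of minimum weight: its neighborhood sums are
  positive integers, so each is at least 1.\<close>

lemma card_verts_le_signed_domination_number:
  assumes "\<And>v. v \<in> pverts G \<Longrightarrow> card (closed_neighborhood G v) = k"
  shows "int (card (pverts G)) \<le> int k * signed_domination_number G"
proof -
  obtain g where g: "signed_dominating G g" "signed_weight G g = signed_domination_number G"
    using signed_domination_number_attained by blast
  have "1 \<le> (\<Sum>u \<in> closed_neighborhood G v. g u)" if "v \<in> pverts G" for v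
    using g(1) that unfolding signed_dominating_def by fastforce
  then have "(\<Sum>v \<in> pverts G. 1) \<le> (\<Sum>v \<in> pverts G. \<Sum>u \<in> closed_neighborhood G v. g u)"
    by (rule sum_mono)
  then show ?thesis
    using g(2) by (simp add: sum_closed_neighborhoods[OF assms])
qed

text \<open>In a complete graph every neighborhood sum is the weight itself, so domination means
  positive weight. The least positive integer, 1, is attained because the order is odd.\<close>

lemma signed_domination_number_complete_odd:
  assumes complete: "\<And>v. v \<in> pverts G \<Longrightarrow> closed_neighborhood G v = pverts G"
    and odd: "odd (card (pverts G))"
  shows "signed_domination_number G = 1"
proof -
  have dom: "signed_dominating G g \<longleftrightarrow> g ` pverts G \<subseteq> {-1, 1} \<and> signed_weight G g > 0" for g
  proof -
    \<comment> \<open>Some vertex must exist for the condition at all vertices to yield positive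
      weight.\<close>
    have "pverts G \<noteq> {}"
      using odd by auto
    then show ?thesis
      by (auto simp: signed_dominating_def signed_weight_def complete)
  qed
  obtain m where m: "card (pverts G) = Suc (2 * m)"
    using odd by (auto elim: oddE)
  then obtain P where P: "P \<subseteq> pverts G" "card P = Suc m"
    using obtain_subset_with_card_n[of "Suc m" "pverts G"] by auto
  \<comment> \<open>With \<open>2 * m + 1\<close> vertices, \<open>m + 1\<close> values
    \<open>1\<close> and \<open>m\<close> values \<open>-1\<close> give weight 1.\<close>
  define g :: "'a \<Rightarrow> int" where "g v = (if v \<in> P then 1 else -1)" for v
  have "signed_weight G g = int (card (pverts G \<inter> P)) - int (card (pverts G - P))"
    by (simp add: signed_weight_def g_def sum.If_cases Diff_eq)
  also have "\<dots> = 1"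
    using P m finite_subset[OF P(1)] by (simp add: card_Diff_subset Int_absorb1)
  finally have w: "signed_weight G g = 1" .
  then have "signed_dominating G g"
    by (auto simp: dom g_def)
  then have "signed_domination_number G \<le> 1"
    using signed_domination_number_le w by fastforce
  moreover have "signed_domination_number G > 0"
    using signed_domination_number_attained dom by auto
  ultimately show ?thesis
    by simp
qed

end

text \<open>The equation \<open>u = s \<otimes> v\<close> says that
  \<open>v \<otimes> inv u = inv s\<close>, and \<open>S\<close> is closed under inverses; the
  vertex \<open>v\<close> itself comes from \<open>\<one>\<close>.\<close>

lemma (in group) closed_neighborhood_cayley_graph:
  assumes S: "S \<subseteq> carrier G" and inv: "set_inv S = S" and v: "v \<in> carrier G"
  shows "closed_neighborhood (cayley_graph S G) v = insert \<one> S #> v"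
proof -
  have "v \<otimes> inv u \<in> S \<longleftrightarrow> (\<exists>s \<in> S. u = s \<otimes> v)" if u: "u \<in> carrier G" for u
  proof
    assume "v \<otimes> inv u \<in> S"
    then have "inv (v \<otimes> inv u) \<in> S"
      using inv unfolding SET_INV_def by blast
    then have "u \<otimes> inv v \<in> S"
      using u v by (simp add: inv_mult_group)
    moreover have "u = (u \<otimes> inv v) \<otimes> v"
      using u v by (simp add: m_assoc)
    ultimately show "\<exists>s \<in> S. u = s \<otimes> v"
      by blast
  next
    assume "\<exists>s \<in> S. u = s \<otimes> v"
    then obtain s where s: "s \<in> S" "u = s \<otimes> v"
      by blast
    then have "v \<otimes> inv u = inv s"
      using S v by (auto simp: inv_mult_group simp flip: m_assoc)
    then show "v \<otimes> inv u \<in> S"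
      using s(1) inv unfolding SET_INV_def by blast
  qed
  then show ?thesis
    using S v by (auto simp: closed_neighborhood_def cayley_graph_def r_coset_def)
qed

lemma (in group) card_closed_neighborhood_cayley_graph:
  assumes fin: "finite (carrier G)" and S: "S \<subseteq> carrier G - {\<one>}" and inv: "set_inv S = S"
    and v: "v \<in> carrier G"
  shows "card (closed_neighborhood (cayley_graph S G) v) = Suc (card S)"
proof -
  have sub: "insert \<one> S \<subseteq> carrier G"
    using S by auto
  \<comment> \<open>Right translation is injective, so this holds for any subset of the group, not
    only for subgroups.\<close>
  have "card (insert \<one> S #> v) = card (insert \<one> S)"
    using card_rcosets_equal[OF rcosetsI[OF sub v] sub] by simp
  also have "\<dots> = Suc (card S)"
    using S fin by (subst card_insert_disjoint) (auto intro: finite_subset)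
  finally show ?thesis
    using S by (subst closed_neighborhood_cayley_graph[OF _ inv v]) auto
qed

theorem theorem2p3:
  fixes G :: "('a, 'b) monoid_scheme" and S :: "'a set" and n :: nat
  assumes "group G"
    and "finite (carrier G)"
    and "order G = n"
    and "S \<subseteq> carrier G - {\<one>\<^bsub>G\<^esub>}"
    and "S = set_inv\<^bsub>G\<^esub> S"
    and "carrier G = generate G S"
  shows "signed_domination_number (cayley_graph S G) = 1 \<longleftrightarrow>
           S = carrier G - {\<one>\<^bsub>G\<^esub>} \<and> odd n"
proof -
  let ?\<Gamma> = "cayley_graph S G"
  interpret group G by fact
  interpret \<Gamma>: pair_graph ?\<Gamma>
    using assms by (intro cayley_graph_is_pair_graph) auto
  have verts: "pverts ?\<Gamma> = carrier G"
    by (simp add: cayley_graph_def)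
  have n: "card (carrier G) = n"
    using assms(3) by (simp add: order_def)
  have regular: "card (closed_neighborhood ?\<Gamma> v) = Suc (card S)" if "v \<in> pverts ?\<Gamma>" for v
    using that assms(2,4,5) verts by (intro card_closed_neighborhood_cayley_graph) auto
  show ?thesis
  proof
    assume one: "signed_domination_number ?\<Gamma> = 1"
    have "n \<le> Suc (card S)"
      using \<Gamma>.card_verts_le_signed_domination_number[OF regular] one verts n by simp
    then have "card (carrier G - {\<one>\<^bsub>G\<^esub>}) \<le> card S"
      using n by simp
    then have "S = carrier G - {\<one>\<^bsub>G\<^esub>}"
      using assms(2,4) by (intro card_seteq) auto
    \<comment> \<open>A dominating function of weight 1 exists, and 1 is odd.\<close>
    moreover have "odd n"
      using \<Gamma>.signed_domination_number_attained even_signed_weight_iff[of ?\<Gamma>] one verts n assms(2)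
      by (metis odd_one)
    ultimately show "S = carrier G - {\<one>\<^bsub>G\<^esub>} \<and> odd n"
      by blast
  next
    assume R: "S = carrier G - {\<one>\<^bsub>G\<^esub>} \<and> odd n"
    show "signed_domination_number ?\<Gamma> = 1"
    proof (rule \<Gamma>.signed_domination_number_complete_odd)
      fix v assume v: "v \<in> pverts ?\<Gamma>"
      \<comment> \<open>Now every closed neighborhood has at least as many elements as the finite
        vertex set containing it, so the two coincide.\<close>
      have "card (carrier G) \<le> Suc (card S)"
        using R assms(2) by simp
      then show "closed_neighborhood ?\<Gamma> v = pverts ?\<Gamma>"
        using v \<Gamma>.closed_neighborhood_subset regular verts
        by (intro card_seteq) (simp_all add: assms(2))
    qed (use R verts n in simp)
  qed
qed

end
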